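(* Let $f_1(x)=\frac12x^\top Q_1x+b_1^\top x$ and $f_2(x)=\frac12x^\top Q_2x+b_2^\top x+c$ on $\mathbb{R}^n$, where $Q_1,Q_2$ are real symmetric $n\times n$ matrices with $\mathrm{Null}(Q_1)\cap\mathrm{Null}(Q_2)=\{0\}$. Assume that $f_1,f_2$ are not both convex, that $f_2(x)<0$ for some $x$, and that $\{\lambda\ge 0: Q_1+\lambda Q_2\succeq 0\}=[\lambda_1,\lambda_2]$ with $\lambda_1<\lambda_2$. Let $h_i(x)=f_1(x)+\lambda_if_2(x)$, $A_i=Q_1+\lambda_iQ_2$, $i=1,2$, $H(x)=\max\{h_1(x),h_2(x)\}$, $L=\max\{\lambda_{\max}(A_1),\lambda_{\max}(A_2)\}$, and let $x^*$ be a minimizer of $H$. Fix $0<\xi\le1$, $0<s<1$, $0<\sigma\le 0.5$ and an initial point $x_0$. Then there is a constant $G>0$, depending only on the initial point and the problem data, such that for all $\rho>0$ and $\delta>0$ the algorithm described in the context (steepest descent with the modified Armijo rule, terminated when $\|d_k\|<\delta$) generates a $(\rho,\delta)$ critical point of $H$ in at most $$\frac{H(x_0)-H(x^* )}{\sigma s\min\{1/L,\ \xi,\ \frac{\rho}{2G^2}\}\,\delta^2}$$ iterations.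
   Context: $\|\cdot\|$ is the Euclidean norm, $\lambda_{\max}$ the largest eigenvalue. For $\rho>0$ define $\partial H_\rho(x)=\{\alpha\nabla h_1(x)+(1-\alpha)\nabla h_2(x):\alpha\in[0,1]\}$ if $|h_1(x)-h_2(x)|\le\rho$; $\partial H_\rho(x)=\{\nabla h_1(x)\}$ if $h_1(x)-h_2(x)>\rho$; $\partial H_\rho(x)=\{\nabla h_2(x)\}$ if $h_2(x)-h_1(x)>\rho$. A point $x$ is a $(\rho,\delta)$ critical point of $H$ if there is $g\in\partial H_\rho(x)$ with $\|g\|<\delta$. Algorithm (parameters $\rho,\delta,\xi,s,\sigma$): for $k=0,1,\dots$, let $g_k$ be the element of $\partial H_\rho(x_k)$ of minimum norm and $d_k=-g_k$. If $\|d_k\|<\delta$, stop and return $x_k$. Otherwise let $\beta_k=\xi s^m$ with $m$ the smallest nonnegative integer such that $H(x_k+\beta_kd_k)\le H(x_k)+\sigma\beta_kd_k^\top g_k$ (that is, $H(x_k+\beta_kd_k)\le H(x_k)-\sigma\beta_k\|g_k\|^2$), and set $x_{k+1}=x_k+\beta_kd_k$. *)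

theory Defs
  imports "HOL-Analysis.Analysis"
begin

definition quadratic :: "real ^ 'n ^ 'n \<Rightarrow> real ^ 'n \<Rightarrow> real \<Rightarrow> real ^ 'n \<Rightarrow> real" where
  "quadratic Q b c x = 1 / 2 * (x \<bullet> (Q *v x)) + b \<bullet> x + c"

definition null_space :: "real ^ 'n ^ 'm \<Rightarrow> (real ^ 'n) set" where
  "null_space A = {v. A *v v = 0}"

definition pos_semidef :: "real ^ 'n ^ 'n \<Rightarrow> bool" where
  "pos_semidef A \<longleftrightarrow> transpose A = A \<and> (\<forall>v. 0 \<le> v \<bullet> (A *v v))"

(* Meaningful when the set of real eigenvalues is finite and nonempty, in particular for
   every symmetric A. *)
definition lambda_max :: "real ^ 'n ^ 'n \<Rightarrow> real" where
  "lambda_max A = Max {\<mu>. \<exists>v. v \<noteq> 0 \<and> A *v v = \<mu> *\<^sub>R v}"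

definition gradient :: "('a::real_inner \<Rightarrow> real) \<Rightarrow> 'a \<Rightarrow> 'a" where
  "gradient h x = (THE D. GDERIV h x :> D)"

definition max_fun :: "('a \<Rightarrow> real) \<Rightarrow> ('a \<Rightarrow> real) \<Rightarrow> 'a \<Rightarrow> real" where
  "max_fun h1 h2 x = max (h1 x) (h2 x)"

definition subdiff :: "real \<Rightarrow> ('a::real_inner \<Rightarrow> real) \<Rightarrow> ('a \<Rightarrow> real) \<Rightarrow> 'a \<Rightarrow> 'a set" where
  "subdiff \<rho> h1 h2 x =
    (if \<bar>h1 x - h2 x\<bar> \<le> \<rho>
     then {\<alpha> *\<^sub>R gradient h1 x + (1 - \<alpha>) *\<^sub>R gradient h2 x | \<alpha>. \<alpha> \<in> {0..1}}
     else if h1 x - h2 x > \<rho> then {gradient h1 x}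
     else {gradient h2 x})"

definition critical_point ::
  "real \<Rightarrow> real \<Rightarrow> ('a::real_inner \<Rightarrow> real) \<Rightarrow> ('a \<Rightarrow> real) \<Rightarrow> 'a \<Rightarrow> bool" where
  "critical_point \<rho> \<delta> h1 h2 x \<longleftrightarrow> (\<exists>g\<in>subdiff \<rho> h1 h2 x. norm g < \<delta>)"

definition min_norm_subgrad ::
  "real \<Rightarrow> ('a::real_inner \<Rightarrow> real) \<Rightarrow> ('a \<Rightarrow> real) \<Rightarrow> 'a \<Rightarrow> 'a \<Rightarrow> bool" where
  "min_norm_subgrad \<rho> h1 h2 x g \<longleftrightarrow> is_arg_min norm (\<lambda>g. g \<in> subdiff \<rho> h1 h2 x) g"

definition armijo ::
  "real \<Rightarrow> ('a::real_inner \<Rightarrow> real) \<Rightarrow> 'a \<Rightarrow> 'a \<Rightarrow> 'a \<Rightarrow> real \<Rightarrow> bool" where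
  "armijo \<sigma> H x g d \<beta> \<longleftrightarrow> H (x + \<beta> *\<^sub>R d) \<le> H x + \<sigma> * \<beta> * (d \<bullet> g)"

definition armijo_step ::
  "real \<Rightarrow> real \<Rightarrow> real \<Rightarrow> ('a::real_inner \<Rightarrow> real) \<Rightarrow> 'a \<Rightarrow> 'a \<Rightarrow> 'a \<Rightarrow> real \<Rightarrow> bool" where
  "armijo_step \<xi> s \<sigma> H x g d \<beta> \<longleftrightarrow>
    (\<exists>m::nat. \<beta> = \<xi> * s ^ m \<and> armijo \<sigma> H x g d (\<xi> * s ^ m) \<and>
       (\<forall>j<m. \<not> armijo \<sigma> H x g d (\<xi> * s ^ j)))"

(* sd_iterate \<rho> \<delta> \<xi> s \<sigma> h1 h2 x0 k x: started at x0, the algorithm performs k updates without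
   stopping earlier, and its k-th iterate is x.  A relation is used rather than a function so
   that no iterate exists beyond a point where the minimum-norm element or the line search
   would fail to be defined. *)
inductive sd_iterate ::
  "real \<Rightarrow> real \<Rightarrow> real \<Rightarrow> real \<Rightarrow> real \<Rightarrow> ('a::real_inner \<Rightarrow> real) \<Rightarrow> ('a \<Rightarrow> real) \<Rightarrow> 'a \<Rightarrow> nat \<Rightarrow> 'a \<Rightarrow> bool"
  for \<rho> \<delta> \<xi> s \<sigma> h1 h2 x0 where
  start: "sd_iterate \<rho> \<delta> \<xi> s \<sigma> h1 h2 x0 0 x0"
| step: "\<lbrakk>sd_iterate \<rho> \<delta> \<xi> s \<sigma> h1 h2 x0 k x; min_norm_subgrad \<rho> h1 h2 x g; d = - g;
          \<not> norm d < \<delta>; armijo_step \<xi> s \<sigma> (max_fun h1 h2) x g d \<beta>\<rbrakk>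
         \<Longrightarrow> sd_iterate \<rho> \<delta> \<xi> s \<sigma> h1 h2 x0 (Suc k) (x + \<beta> *\<^sub>R d)"

(* The algorithm stops after exactly k updates and returns x. *)
definition sd_returns ::
  "real \<Rightarrow> real \<Rightarrow> real \<Rightarrow> real \<Rightarrow> real \<Rightarrow> ('a::real_inner \<Rightarrow> real) \<Rightarrow> ('a \<Rightarrow> real) \<Rightarrow> 'a \<Rightarrow> nat \<Rightarrow> 'a \<Rightarrow> bool" where
  "sd_returns \<rho> \<delta> \<xi> s \<sigma> h1 h2 x0 k x \<longleftrightarrow>
    sd_iterate \<rho> \<delta> \<xi> s \<sigma> h1 h2 x0 k x \<and>
    (\<exists>g d. min_norm_subgrad \<rho> h1 h2 x g \<and> d = - g \<and> norm d < \<delta>)"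

end

theory Submission
  imports Defs
begin

text \<open>Let \<open>g\<close> be the minimum-norm element of \<open>\<partial>H\<^sub>\<rho>(x)\<close>. If \<open>\<bar>h\<^sub>1 - h\<^sub>2\<bar> \<le> \<rho>\<close> at \<open>x\<close>, then by the
  projection inequality \<open>\<nabla>h\<^sub>i \<bullet> g \<ge> \<parallel>g\<parallel>\<^sup>2\<close> for both \<open>i\<close>, and the descent lemma gives the Armijo
  inequality for every step \<open>\<beta> \<le> 1/L\<close>. If, say, \<open>h\<^sub>1 - h\<^sub>2 > \<rho>\<close>, then \<open>h\<^sub>1\<close> decreases as before, while
  \<open>h\<^sub>2\<close> grows too little to catch up as long as also \<open>\<beta> \<le> \<rho>/(2G\<^sup>2)\<close>, where \<open>G\<close> bounds both gradients
  on the sublevel set of \<open>x\<^sub>0\<close>. Backtracking therefore loses at most a factor \<open>s\<close> against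
  \<open>min {1/L, \<xi>, \<rho>/(2G\<^sup>2)}\<close>, so each iteration lowers \<open>H\<close> by a fixed amount. The bound \<open>G\<close> exists
  because \<open>(A\<^sub>1 + A\<^sub>2)/2\<close> is positive definite: a null vector would be annihilated by \<open>A\<^sub>1\<close> and
  \<open>A\<^sub>2\<close>, hence by \<open>Q\<^sub>1\<close> and \<open>Q\<^sub>2\<close>. Since \<open>H \<ge> (h\<^sub>1 + h\<^sub>2)/2\<close>, sublevel sets of \<open>H\<close> are bounded.\<close>

section \<open>Symmetric matrices\<close>

lemma inner_matrix_symmetric:
  fixes A :: "real ^ 'n ^ 'n"
  assumes "transpose A = A"
  shows "x \<bullet> (A *v y) = (A *v x) \<bullet> y"
  by (metis assms dot_lmul_matrix inner_commute transpose_matrix_vector)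

text \<open>With \<open>w = A *v u\<close>, the form at \<open>u - t *\<^sub>R w\<close> is
  \<open>- 2 * t * (w \<bullet> w)\<close> plus a term quadratic in \<open>t\<close>, hence negative
  for small positive \<open>t\<close> unless \<open>w = 0\<close>.\<close>

lemma pos_semidef_null:
  fixes A :: "real ^ 'n ^ 'n"
  assumes "pos_semidef A" and "u \<bullet> (A *v u) = 0"
  shows "A *v u = 0"
proof (rule ccontr)
  assume "A *v u \<noteq> 0"
  define w where "w = A *v u"
  define q where "q = w \<bullet> (A *v w)"
  \<comment> \<open>The summand 1 keeps the denominator positive when \<open>q = 0\<close>. Since
    \<open>t * (1 + q) = w \<bullet> w\<close>, the quadratic term cancels only half of the linear
    one.\<close>
  define t where "t = (w \<bullet> w) / (1 + q)"
  have sym: "transpose A = A" and psd: "\<And>v. 0 \<le> v \<bullet> (A *v v)"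
    using assms(1) by (auto simp: pos_semidef_def)
  have ww: "w \<bullet> w > 0" using \<open>A *v u \<noteq> 0\<close> by (simp add: w_def)
  have q0: "q \<ge> 0" using psd q_def by simp
  have "0 \<le> (u - t *\<^sub>R w) \<bullet> (A *v (u - t *\<^sub>R w))" by (rule psd)
  also have "\<dots> = - 2 * t * (w \<bullet> w) + t\<^sup>2 * q"
    using assms(2) inner_matrix_symmetric[OF sym, of u w]
    by (simp add: matrix_vector_mult_diff_distrib matrix_vector_mult_scaleR inner_diff_left
        inner_diff_right q_def w_def[symmetric] inner_commute power2_eq_square algebra_simps)
  also have "\<dots> \<le> - 2 * t * (w \<bullet> w) + t\<^sup>2 * (1 + q)"
    by (simp add: algebra_simps)
  also have "\<dots> = - ((w \<bullet> w) * t)"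
    using q0 by (simp add: t_def power2_eq_square)
  also have "\<dots> < 0" using ww q0 by (simp add: t_def)
  finally show False by simp
qed

text \<open>The unit sphere is compact and the form is homogeneous of degree two. Naming the
  maximizer instead of an eigenvalue lets the lemma serve also for \<open>- B\<close>, where it
  yields a minimum.\<close>

lemma rayleigh_max:
  fixes A :: "real ^ 'n ^ 'n"
  obtains u where "norm u = 1" and "\<And>v. v \<bullet> (A *v v) \<le> (u \<bullet> (A *v u)) * (norm v)\<^sup>2"
proof -
  let ?S = "sphere (0 :: real ^ 'n) 1"
  have "continuous_on ?S (\<lambda>v. v \<bullet> (A *v v))"
    by (intro continuous_intros linear_continuous_on matrix_vector_mul_bounded_linear)
  moreover have "?S \<noteq> {}" by simp
  ultimately obtain u where u: "u \<in> ?S" and le: "\<And>v. v \<in> ?S \<Longrightarrow> v \<bullet> (A *v v) \<le> u \<bullet> (A *v u)"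
    using continuous_attains_sup[OF compact_sphere] by blast
  show thesis
  proof
    show "norm u = 1" using u by simp
    fix v
    show "v \<bullet> (A *v v) \<le> (u \<bullet> (A *v u)) * (norm v)\<^sup>2"
    proof (cases "v = 0")
      case False
      then have "v /\<^sub>R norm v \<in> ?S" by simp
      from le[OF this] False show ?thesis
        by (simp add: matrix_vector_mult_scaleR field_simps power2_eq_square)
    qed simp
  qed
qed

text \<open>Gives \<open>Max\<close> in \<open>lambda_max\<close> its meaning. Eigenvectors of
  distinct eigenvalues are orthogonal, hence independent, and the dimension is finite.\<close>

lemma finite_eigenvalues:
  fixes A :: "real ^ 'n ^ 'n"
  assumes "transpose A = A"
  shows "finite {\<mu>. \<exists>v. v \<noteq> 0 \<and> A *v v = \<mu> *\<^sub>R v}" (is "finite ?E")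
proof -
  have "\<forall>\<mu>\<in>?E. \<exists>v. v \<noteq> 0 \<and> A *v v = \<mu> *\<^sub>R v" by simp
  from bchoice[OF this] obtain e where e: "\<And>\<mu>. \<mu> \<in> ?E \<Longrightarrow> e \<mu> \<noteq> 0 \<and> A *v e \<mu> = \<mu> *\<^sub>R e \<mu>"
    by blast
  have inj: "inj_on e ?E"
  proof (rule inj_onI)
    fix \<mu> \<nu>
    assume \<mu>\<nu>: "\<mu> \<in> ?E" "\<nu> \<in> ?E" and "e \<mu> = e \<nu>"
    then have "\<mu> *\<^sub>R e \<mu> = \<nu> *\<^sub>R e \<mu>"
      using e[OF \<mu>\<nu>(1)] e[OF \<mu>\<nu>(2)] by metis
    then show "\<mu> = \<nu>" using e[OF \<mu>\<nu>(1)] by simp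
  qed
  have orth: "e \<mu> \<bullet> e \<nu> = 0" if "\<mu> \<in> ?E" "\<nu> \<in> ?E" "\<mu> \<noteq> \<nu>" for \<mu> \<nu>
  proof -
    have "e \<mu> \<bullet> (\<nu> *\<^sub>R e \<nu>) = (\<mu> *\<^sub>R e \<mu>) \<bullet> e \<nu>"
      using inner_matrix_symmetric[OF assms, of "e \<mu>" "e \<nu>"] e[OF that(1)] e[OF that(2)] by metis
    then show ?thesis using that(3) by simp
  qed
  have "independent (e ` ?E)"
  proof (rule pairwise_orthogonal_independent)
    show "pairwise orthogonal (e ` ?E)"
      using orth by (fastforce simp: pairwise_def orthogonal_def)
    show "0 \<notin> e ` ?E" using e by force
  qed
  then have "finite (e ` ?E)" using independent_bound by blast
  then show ?thesis using inj by (rule finite_imageD)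
qed

text \<open>If \<open>u\<close> maximizes the form on the sphere with value \<open>M\<close>, then
  \<open>M *\<^sub>R mat 1 - A\<close> is positive semidefinite with vanishing form at
  \<open>u\<close>, so it annihilates \<open>u\<close>. Thus \<open>M\<close> is an
  eigenvalue.\<close>

lemma quadratic_form_le_lambda_max:
  fixes A :: "real ^ 'n ^ 'n"
  assumes sym: "transpose A = A"
  shows "v \<bullet> (A *v v) \<le> lambda_max A * (norm v)\<^sup>2"
proof -
  obtain u where u: "norm u = 1"
    and le: "\<And>v. v \<bullet> (A *v v) \<le> (u \<bullet> (A *v u)) * (norm v)\<^sup>2"
    using rayleigh_max[of A] by blast
  define M where "M = u \<bullet> (A *v u)"
  define B where "B = M *\<^sub>R mat 1 - A"
  have B: "B *v w = M *\<^sub>R w - A *v w" for w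
    by (simp add: B_def matrix_vector_mult_diff_rdistrib flip: scaleR_matrix_vector_assoc)
  have "transpose B = B"
    using sym by (simp add: B_def transpose_def vec_eq_iff mat_def)
  then have "pos_semidef B"
    using le by (simp add: pos_semidef_def B inner_diff_right M_def power2_norm_eq_inner)
  moreover have "u \<bullet> (B *v u) = 0"
    using u by (simp add: B inner_diff_right M_def flip: power2_norm_eq_inner)
  ultimately have "B *v u = 0" by (rule pos_semidef_null)
  then have "A *v u = M *\<^sub>R u" by (simp add: B)
  moreover have "u \<noteq> 0" using u by auto
  ultimately have "M \<le> lambda_max A"
    unfolding lambda_max_def using finite_eigenvalues[OF sym] by (intro Max_ge) auto
  then show ?thesis
    using le[of v] by (smt (verit) M_def mult_right_mono zero_le_power2)
qed

lemma lambda_max_pos: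
  fixes A :: "real ^ 'n ^ 'n"
  assumes "pos_semidef A" and "A *v v \<noteq> 0"
  shows "0 < lambda_max A"
proof -
  have sym: "transpose A = A" and "0 \<le> v \<bullet> (A *v v)"
    using assms(1) by (auto simp: pos_semidef_def)
  then have "0 < v \<bullet> (A *v v)"
    using pos_semidef_null[OF assms(1), of v] assms(2) by linarith
  then have "0 < lambda_max A * (norm v)\<^sup>2"
    using quadratic_form_le_lambda_max[OF sym, of v] by simp
  then show ?thesis by (simp add: zero_less_mult_iff)
qed

section \<open>Quadratic functions: expansion, gradient, descent inequality, bounded sublevel
  sets\<close>

lemma quadratic_add:
  fixes A :: "real ^ 'n ^ 'n"
  assumes "transpose A = A"
  shows "quadratic A b c (x + d) =
    quadratic A b c x + (A *v x + b) \<bullet> d + 1 / 2 * (d \<bullet> (A *v d))"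
  using inner_matrix_symmetric[OF assms, of d x] inner_matrix_symmetric[OF assms, of x d]
  by (simp add: quadratic_def matrix_vector_right_distrib inner_add_left inner_add_right
      inner_commute)

lemma gradient_quadratic:
  fixes A :: "real ^ 'n ^ 'n"
  assumes "transpose A = A"
  shows "gradient (quadratic A b c) x = A *v x + b"
proof -
  have "(quadratic A b c has_derivative
      (\<lambda>d. 1 / 2 * (x \<bullet> (A *v d) + d \<bullet> (A *v x)) + b \<bullet> d)) (at x)"
    unfolding quadratic_def
    by (auto intro!: derivative_eq_intros
        bounded_linear.has_derivative[OF matrix_vector_mul_bounded_linear])
  moreover have "(\<lambda>d. 1 / 2 * (x \<bullet> (A *v d) + d \<bullet> (A *v x)) + b \<bullet> d)
      = (\<lambda>d. d \<bullet> (A *v x + b))"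
    using inner_matrix_symmetric[OF assms, of x]
    by (auto simp: inner_add_right inner_commute)
  ultimately have "GDERIV (quadratic A b c) x :> A *v x + b"
    by (simp add: gderiv_def)
  \<comment> \<open>\<open>gradient\<close> is a definite description, so uniqueness of the
    derivative has to be supplied.\<close>
  moreover have "D = A *v x + b" if "GDERIV (quadratic A b c) x :> D" for D
  proof -
    have "(\<lambda>d. d \<bullet> D) = (\<lambda>d. d \<bullet> (A *v x + b))"
      using that calculation unfolding gderiv_def by (rule has_derivative_unique)
    then show ?thesis by (metis vector_eq_ldot)
  qed
  ultimately show ?thesis unfolding gradient_def by (rule the_equality)
qed

lemma quadratic_descent:
  fixes A :: "real ^ 'n ^ 'n"
  assumes sym: "transpose A = A" and L: "lambda_max A \<le> L"
  shows "quadratic A b c (x + d) \<le>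
    quadratic A b c x + gradient (quadratic A b c) x \<bullet> d + L / 2 * (norm d)\<^sup>2"
proof -
  have "d \<bullet> (A *v d) \<le> L * (norm d)\<^sup>2"
    using quadratic_form_le_lambda_max[OF sym, of d] L
    by (smt (verit) mult_right_mono zero_le_power2)
  then show ?thesis by (simp add: quadratic_add[OF sym] gradient_quadratic[OF sym])
qed

text \<open>By compactness the form is at least \<open>m * (norm v)\<^sup>2\<close> with
  \<open>m > 0\<close>, and this growth beats the linear term.\<close>

lemma bounded_quadratic_sublevel:
  fixes B :: "real ^ 'n ^ 'n"
  assumes pd: "\<And>v. v \<noteq> 0 \<Longrightarrow> 0 < v \<bullet> (B *v v)"
  shows "bounded {x. quadratic B b c x \<le> K}"
proof -
  obtain u where u: "norm u = 1"
    and le: "\<And>v. v \<bullet> (- B *v v) \<le> (u \<bullet> (- B *v u)) * (norm v)\<^sup>2"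
    using rayleigh_max[of "- B"] by blast
  have neg: "- B *v v = - (B *v v)" for v
    using scaleR_matrix_vector_assoc[of "- 1" B v] by simp
  define m where "m = u \<bullet> (B *v u)"
  have "u \<noteq> 0" using u by auto
  then have m: "m > 0" using pd m_def by simp
  have ge: "m * (norm v)\<^sup>2 \<le> v \<bullet> (B *v v)" for v
    using le[of v] by (simp add: neg m_def)
  \<comment> \<open>Chosen so that \<open>m / 2 * R\<close> exceeds
    \<open>norm b + \<bar>K - c\<bar>\<close>; as \<open>R\<close> is at least 1, the constant
    \<open>\<bar>K - c\<bar>\<close> can be absorbed after multiplying by
    \<open>norm x\<close>.\<close>
  define R where "R = 1 + 2 / m * (norm b + \<bar>K - c\<bar>)"
  have R1: "R \<ge> 1" using m by (simp add: R_def)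
  have "norm x \<le> R" if x: "quadratic B b c x \<le> K" for x
  proof (rule ccontr)
    assume "\<not> norm x \<le> R"
    then have r: "norm x > R" "norm x \<ge> 1" using R1 by auto
    have "norm b + \<bar>K - c\<bar> < m / 2 * R"
      using m by (simp add: R_def field_simps)
    also have "\<dots> \<le> m / 2 * norm x" using r m by simp
    finally have 1: "norm x * (norm b + \<bar>K - c\<bar>) < norm x * (m / 2 * norm x)"
      using r by (intro mult_strict_left_mono) auto
    have 2: "\<bar>K - c\<bar> \<le> norm x * \<bar>K - c\<bar>"
      using r(2) by (simp add: mult_le_cancel_right1)
    have 3: "- (b \<bullet> x) \<le> norm b * norm x"
      using Cauchy_Schwarz_ineq2[of b x] by linarith
    have "K < 1 / 2 * (m * (norm x)\<^sup>2) + b \<bullet> x + c"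
      using 1 2 3 by (simp add: algebra_simps power2_eq_square)
    also have "\<dots> \<le> quadratic B b c x"
      using ge[of x] by (simp add: quadratic_def)
    finally show False using x by simp
  qed
  then show ?thesis by (auto simp: bounded_iff)
qed

section \<open>Steepest descent for the maximum of two smooth functions\<close>

text \<open>Makes compactness and convexity available, for the existence of the minimum-norm element
  and for the projection inequality.\<close>

lemma subdiff_eq_segment:
  assumes "\<bar>h1 x - h2 x\<bar> \<le> \<rho>"
  shows "subdiff \<rho> h1 h2 x = closed_segment (gradient h2 x) (gradient h1 x)"
  using assms by (force simp: subdiff_def in_segment algebra_simps)

lemma min_norm_subgrad_exists:
  fixes h1 h2 :: "'a::euclidean_space \<Rightarrow> real"
  obtains g where "min_norm_subgrad \<rho> h1 h2 x g"
proof -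
  have "compact (subdiff \<rho> h1 h2 x) \<and> subdiff \<rho> h1 h2 x \<noteq> {}"
  proof (cases "\<bar>h1 x - h2 x\<bar> \<le> \<rho>")
    case True
    show ?thesis unfolding subdiff_eq_segment[of h1 x h2, OF True] by auto
  qed (simp add: subdiff_def)
  then obtain g where "g \<in> subdiff \<rho> h1 h2 x" "\<And>y. y \<in> subdiff \<rho> h1 h2 x \<Longrightarrow> norm g \<le> norm y"
    using continuous_attains_inf[of "subdiff \<rho> h1 h2 x" norm] continuous_on_norm_id by blast
  then show thesis
    by (intro that[of g]) (force simp: min_norm_subgrad_def is_arg_min_def)
qed

text \<open>\<open>g\<close> is the projection of 0 onto the segment; its variational inequality is
  evaluated at the two endpoints.\<close>

lemma min_norm_subgrad_inner:
  fixes h1 h2 :: "'a::euclidean_space \<Rightarrow> real"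
  assumes near: "\<bar>h1 x - h2 x\<bar> \<le> \<rho>" and g: "min_norm_subgrad \<rho> h1 h2 x g"
  shows "(norm g)\<^sup>2 \<le> gradient h1 x \<bullet> g" and "(norm g)\<^sup>2 \<le> gradient h2 x \<bullet> g"
proof -
  let ?S = "closed_segment (gradient h2 x) (gradient h1 x)"
  have "g \<in> ?S" "\<forall>z\<in>?S. dist 0 g \<le> dist 0 z"
    using g by (auto simp: min_norm_subgrad_def is_arg_min_linorder subdiff_eq_segment[of h1 x h2, OF near])
  then have "(0 - g) \<bullet> (y - g) \<le> 0" if "y \<in> ?S" for y
    using any_closest_point_dot[OF convex_closed_segment closed_segment _ that] by blast
  then have "(norm g)\<^sup>2 \<le> y \<bullet> g" if "y \<in> ?S" for y
    using that by (force simp: power2_norm_eq_inner inner_diff_right inner_commute)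
  then show "(norm g)\<^sup>2 \<le> gradient h1 x \<bullet> g" "(norm g)\<^sup>2 \<le> gradient h2 x \<bullet> g" by auto
qed

section \<open>Backtracking line search\<close>

lemma armijo_step_exists:
  assumes "0 < \<xi>" "0 < s" "s < 1" "0 < \<tau>"
    and small: "\<And>\<beta>. 0 < \<beta> \<Longrightarrow> \<beta> \<le> \<tau> \<Longrightarrow> armijo \<sigma> H x g d \<beta>"
  obtains \<beta> where "armijo_step \<xi> s \<sigma> H x g d \<beta>"
proof -
  obtain m where "s ^ m < \<tau> / \<xi>"
    using real_arch_pow_inv[of "\<tau> / \<xi>" s] assms by auto
  then have "armijo \<sigma> H x g d (\<xi> * s ^ m)"
    using assms by (intro small) (auto simp: field_simps)
  then obtain m where "armijo \<sigma> H x g d (\<xi> * s ^ m)" "\<And>j. j < m \<Longrightarrow> \<not> armijo \<sigma> H x g d (\<xi> * s ^ j)"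
    using exists_least_iff[of "\<lambda>m. armijo \<sigma> H x g d (\<xi> * s ^ m)"] by blast
  then show thesis using that by (auto simp: armijo_step_def)
qed

text \<open>Either the first trial \<open>\<xi>\<close> is accepted, or the preceding trial
  \<open>\<beta> / s\<close> was rejected and therefore exceeds \<open>\<tau>\<close>.\<close>

lemma armijo_step_ge:
  assumes "0 < \<xi>" "0 < s" "s < 1"
    and small: "\<And>\<beta>. 0 < \<beta> \<Longrightarrow> \<beta> \<le> \<tau> \<Longrightarrow> armijo \<sigma> H x g d \<beta>"
    and step: "armijo_step \<xi> s \<sigma> H x g d \<beta>"
  shows "s * min \<tau> \<xi> \<le> \<beta>"
proof -
  obtain m where \<beta>: "\<beta> = \<xi> * s ^ m" and no: "\<And>j. j < m \<Longrightarrow> \<not> armijo \<sigma> H x g d (\<xi> * s ^ j)"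
    using step by (auto simp: armijo_step_def)
  show ?thesis
  proof (cases m)
    case 0
    have "s * min \<tau> \<xi> \<le> s * \<xi>" using assms by simp
    also have "\<dots> \<le> \<xi>" using assms by (simp add: mult_left_le_one_le)
    finally show ?thesis using 0 \<beta> by simp
  next
    case (Suc j)
    then have "\<tau> < \<xi> * s ^ j"
      using no[of j] small[of "\<xi> * s ^ j"] assms by fastforce
    then have "s * min \<tau> \<xi> \<le> s * (\<xi> * s ^ j)"
      using assms by (intro mult_left_mono) auto
    then show ?thesis using \<beta> Suc by (simp add: mult_ac)
  qed
qed

text \<open>Collects what the analysis of the iteration uses of the two quadratics: a descent
  inequality with a common constant, and gradient bounds on the initial sublevel set.\<close>

locale smooth_pair =
  fixes h1 h2 :: "'a::euclidean_space \<Rightarrow> real" and L G :: real and x0 :: 'a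
  assumes descent1: "\<And>x d. h1 (x + d) \<le> h1 x + gradient h1 x \<bullet> d + L / 2 * (norm d)\<^sup>2"
    and descent2: "\<And>x d. h2 (x + d) \<le> h2 x + gradient h2 x \<bullet> d + L / 2 * (norm d)\<^sup>2"
    and L_pos: "0 < L" and G_pos: "0 < G"
    and grad1_le: "\<And>x. max_fun h1 h2 x \<le> max_fun h1 h2 x0 \<Longrightarrow> norm (gradient h1 x) \<le> G"
    and grad2_le: "\<And>x. max_fun h1 h2 x \<le> max_fun h1 h2 x0 \<Longrightarrow> norm (gradient h2 x) \<le> G"
begin

text \<open>For such steps curvature costs at most half of a first-order gain
  \<open>\<beta> * (norm g)\<^sup>2\<close>; the remaining half is what
  \<open>\<sigma> \<le> 1 / 2\<close> relies on.\<close>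

lemma curvature_term_le:
  assumes "0 < \<beta>" "\<beta> \<le> 1 / L"
  shows "L / 2 * (norm (\<beta> *\<^sub>R g))\<^sup>2 \<le> \<beta> / 2 * (norm g)\<^sup>2"
proof -
  have "L * \<beta> \<le> 1" using assms(2) L_pos by (simp add: field_simps)
  then have "(L * \<beta>) * (\<beta> / 2 * (norm g)\<^sup>2) \<le> 1 * (\<beta> / 2 * (norm g)\<^sup>2)"
    using assms(1) by (intro mult_right_mono) auto
  then show ?thesis by (simp add: power2_eq_square mult_ac)
qed

lemma step1_le:
  assumes "0 < \<beta>" "\<beta> \<le> 1 / L"
  shows "h1 (x + \<beta> *\<^sub>R (- g)) \<le> h1 x - \<beta> * (gradient h1 x \<bullet> g) + \<beta> / 2 * (norm g)\<^sup>2"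
  using descent1[of x "\<beta> *\<^sub>R (- g)"] curvature_term_le[OF assms, of g] by simp

lemma step2_le:
  assumes "0 < \<beta>" "\<beta> \<le> 1 / L"
  shows "h2 (x + \<beta> *\<^sub>R (- g)) \<le> h2 x - \<beta> * (gradient h2 x \<bullet> g) + \<beta> / 2 * (norm g)\<^sup>2"
  using descent2[of x "\<beta> *\<^sub>R (- g)"] curvature_term_le[OF assms, of g] by simp

text \<open>Here \<open>v\<close> is the gradient of the smaller function. The term
  \<open>\<beta> * (norm g)\<^sup>2\<close> joins its curvature term to the decrease demanded, half
  each. Both summands are at most \<open>\<beta> * G\<^sup>2\<close>, whence the factor 2 in the
  step bound.\<close>

lemma growth_le:
  assumes "0 < \<beta>" "\<beta> \<le> \<rho> / (2 * G\<^sup>2)" "norm v \<le> G" "norm g \<le> G"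
  shows "- \<beta> * (v \<bullet> g) + \<beta> * (norm g)\<^sup>2 \<le> \<rho>"
proof -
  have "- (v \<bullet> g) \<le> norm v * norm g"
    using Cauchy_Schwarz_ineq2[of v g] by linarith
  also have "\<dots> \<le> G * G" using assms G_pos by (intro mult_mono) auto
  finally have "- (v \<bullet> g) \<le> G\<^sup>2" by (simp add: power2_eq_square)
  moreover have "(norm g)\<^sup>2 \<le> G\<^sup>2" using assms by (intro power_mono) auto
  ultimately have "\<beta> * (- (v \<bullet> g) + (norm g)\<^sup>2) \<le> \<beta> * (2 * G\<^sup>2)"
    using assms(1) by (intro mult_left_mono) auto
  also have "\<dots> \<le> \<rho>" using assms(2) G_pos by (simp add: field_simps)
  finally show ?thesis by (simp add: algebra_simps)
qed

lemma small_step_armijo: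
  assumes "0 < \<rho>" "\<sigma> \<le> 1 / 2" and x: "max_fun h1 h2 x \<le> max_fun h1 h2 x0"
    and g: "min_norm_subgrad \<rho> h1 h2 x g"
    and \<beta>: "0 < \<beta>" "\<beta> \<le> 1 / L" "\<beta> \<le> \<rho> / (2 * G\<^sup>2)"
  shows "armijo \<sigma> (max_fun h1 h2) x g (- g) \<beta>"
proof -
  let ?y = "x + \<beta> *\<^sub>R (- g)"
  note s1 = step1_le[OF \<beta>(1,2), of x g] and s2 = step2_le[OF \<beta>(1,2), of x g]
  have "h1 ?y \<le> max_fun h1 h2 x - \<beta> / 2 * (norm g)\<^sup>2 \<and>
        h2 ?y \<le> max_fun h1 h2 x - \<beta> / 2 * (norm g)\<^sup>2"
  proof -
    consider "\<bar>h1 x - h2 x\<bar> \<le> \<rho>" | "h1 x - h2 x > \<rho>" | "h2 x - h1 x > \<rho>" by linarith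
    then show ?thesis
    proof cases
      case 1
      have "\<beta> * (norm g)\<^sup>2 \<le> \<beta> * (gradient h1 x \<bullet> g)" "\<beta> * (norm g)\<^sup>2 \<le> \<beta> * (gradient h2 x \<bullet> g)"
        using min_norm_subgrad_inner[OF 1 g] \<beta>(1) by simp_all
      with s1 s2 show ?thesis by (auto simp: max_fun_def)
    next
      \<comment> \<open>The subdifferential is a singleton. The larger function decreases as in the
        first case, while the smaller one starts more than \<open>\<rho>\<close> below it and so
        stays under the target value.\<close>
      case 2
      then have g1: "g = gradient h1 x"
        using g \<open>0 < \<rho>\<close> by (simp add: min_norm_subgrad_def is_arg_min_def subdiff_def)
      then have "\<beta> * (norm g)\<^sup>2 = \<beta> * (gradient h1 x \<bullet> g)" by (simp add: power2_norm_eq_inner)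
      moreover have "- \<beta> * (gradient h2 x \<bullet> g) + \<beta> * (norm g)\<^sup>2 \<le> \<rho>"
        using growth_le[OF \<beta>(1,3)] grad1_le[OF x] grad2_le[OF x] g1 by blast
      ultimately show ?thesis using s1 s2 2 \<open>0 < \<rho>\<close> by (auto simp: max_fun_def)
    next
      case 3
      then have g2: "g = gradient h2 x"
        using g \<open>0 < \<rho>\<close> by (simp add: min_norm_subgrad_def is_arg_min_def subdiff_def)
      then have "\<beta> * (norm g)\<^sup>2 = \<beta> * (gradient h2 x \<bullet> g)" by (simp add: power2_norm_eq_inner)
      moreover have "- \<beta> * (gradient h1 x \<bullet> g) + \<beta> * (norm g)\<^sup>2 \<le> \<rho>"
        using growth_le[OF \<beta>(1,3)] grad1_le[OF x] grad2_le[OF x] g2 by blast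
      ultimately show ?thesis using s1 s2 3 \<open>0 < \<rho>\<close> by (auto simp: max_fun_def)
    qed
  qed
  then have "max_fun h1 h2 ?y \<le> max_fun h1 h2 x - 1 / 2 * (\<beta> * (norm g)\<^sup>2)"
    unfolding max_fun_def[of h1 h2 ?y] max.bounded_iff by simp
  moreover have "\<sigma> * (\<beta> * (norm g)\<^sup>2) \<le> 1 / 2 * (\<beta> * (norm g)\<^sup>2)"
    using assms(2) \<beta>(1) by (intro mult_right_mono) auto
  ultimately show ?thesis
    by (simp add: armijo_def mult.assoc flip: power2_norm_eq_inner)
qed

section \<open>The iteration: decrease, iteration bound, termination\<close>

context
  fixes \<rho> \<delta> \<xi> s \<sigma> :: real
  assumes pos: "0 < \<rho>" "0 < \<delta>" "0 < \<xi>" "0 < s" "s < 1" "0 < \<sigma>" "\<sigma> \<le> 1 / 2"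
begin

text \<open>The guaranteed decrease of the objective per update, and so the denominator of the
  iteration bound.\<close>

abbreviation (input) "\<mu> \<equiv> \<sigma> * s * min (1 / L) (min \<xi> (\<rho> / (2 * G\<^sup>2))) * \<delta>\<^sup>2"

lemma decrease_pos: "0 < \<mu>"
  using pos L_pos G_pos by simp

lemma sd_iterate_decrease:
  assumes "sd_iterate \<rho> \<delta> \<xi> s \<sigma> h1 h2 x0 k x"
  shows "max_fun h1 h2 x \<le> max_fun h1 h2 x0 - real k * \<mu>"
  using assms
proof induction
  case (step k x g d \<beta>)
  \<comment> \<open>The induction hypothesis keeps the iterate in the initial sublevel set, where
    the gradient bounds hold.\<close>
  have x: "max_fun h1 h2 x \<le> max_fun h1 h2 x0"
    using step.IH decrease_pos by (smt (verit) mult_nonneg_nonneg of_nat_0_le_iff)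
  have "s * min (min (1 / L) (\<rho> / (2 * G\<^sup>2))) \<xi> \<le> \<beta>"
    by (rule armijo_step_ge[OF pos(3-5) _ step.hyps(5)])
      (use small_step_armijo[OF pos(1,7) x step.hyps(2)] step.hyps(3) in auto)
  then have \<beta>: "s * min (1 / L) (min \<xi> (\<rho> / (2 * G\<^sup>2))) \<le> \<beta>" by (simp add: min.commute min.left_commute)
  have "\<delta>\<^sup>2 \<le> (norm g)\<^sup>2" using step.hyps pos by (intro power_mono) auto
  with \<beta> have "(s * min (1 / L) (min \<xi> (\<rho> / (2 * G\<^sup>2)))) * \<delta>\<^sup>2 \<le> \<beta> * (norm g)\<^sup>2"
    using pos L_pos G_pos by (intro mult_mono) (auto intro: order_trans[OF _ \<beta>])
  then have "\<mu> \<le> \<sigma> * (\<beta> * (norm g)\<^sup>2)"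
    using pos(6) by (simp add: mult.assoc)
  moreover have "max_fun h1 h2 (x + \<beta> *\<^sub>R d) \<le> max_fun h1 h2 x - \<sigma> * (\<beta> * (norm g)\<^sup>2)"
    using step.hyps(3,5) by (auto simp: armijo_step_def armijo_def mult.assoc power2_norm_eq_inner)
  ultimately show ?case using step.IH by (simp add: algebra_simps)
qed simp

lemma sd_iterate_bound:
  assumes "sd_iterate \<rho> \<delta> \<xi> s \<sigma> h1 h2 x0 k x" and "max_fun h1 h2 xstar \<le> max_fun h1 h2 x"
  shows "real k \<le> (max_fun h1 h2 x0 - max_fun h1 h2 xstar) / \<mu>"
  using sd_iterate_decrease[OF assms(1)] assms(2) by (simp only: pos_le_divide_eq[OF decrease_pos])

text \<open>As a relation, \<open>sd_iterate\<close> could get stuck. Both choices of an update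
  exist, however, so a run can end only by returning.\<close>

lemma sd_iterate_progress:
  assumes it: "sd_iterate \<rho> \<delta> \<xi> s \<sigma> h1 h2 x0 k x"
    and "\<not> sd_returns \<rho> \<delta> \<xi> s \<sigma> h1 h2 x0 k x"
  obtains y where "sd_iterate \<rho> \<delta> \<xi> s \<sigma> h1 h2 x0 (Suc k) y"
proof -
  obtain g where g: "min_norm_subgrad \<rho> h1 h2 x g" by (rule min_norm_subgrad_exists)
  have \<delta>: "\<not> norm (- g) < \<delta>" using assms g unfolding sd_returns_def by blast
  have x: "max_fun h1 h2 x \<le> max_fun h1 h2 x0"
    using sd_iterate_decrease[OF it] decrease_pos by (smt (verit) mult_nonneg_nonneg of_nat_0_le_iff)
  obtain \<beta> where "armijo_step \<xi> s \<sigma> (max_fun h1 h2) x g (- g) \<beta>"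
  proof (rule armijo_step_exists[OF pos(3-5)])
    show "0 < min (1 / L) (\<rho> / (2 * G\<^sup>2))" using pos L_pos G_pos by simp
  qed (use small_step_armijo[OF pos(1,7) x g] in auto)
  then show thesis using that sd_iterate.step[OF it g refl \<delta>] by blast
qed

text \<open>Otherwise there would be iterates of every index, against the bound on
  \<open>k\<close>.\<close>

lemma sd_terminates:
  assumes min: "\<And>x. max_fun h1 h2 xstar \<le> max_fun h1 h2 x"
  shows "\<exists>k x. sd_returns \<rho> \<delta> \<xi> s \<sigma> h1 h2 x0 k x"
proof (rule ccontr)
  assume no: "\<nexists>k x. sd_returns \<rho> \<delta> \<xi> s \<sigma> h1 h2 x0 k x"
  have "\<exists>x. sd_iterate \<rho> \<delta> \<xi> s \<sigma> h1 h2 x0 k x" for k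
  proof (induction k)
    case 0
    show ?case using sd_iterate.start by blast
  next
    case (Suc k)
    then show ?case using sd_iterate_progress no by metis
  qed
  then have "real k \<le> (max_fun h1 h2 x0 - max_fun h1 h2 xstar) / \<mu>" for k
    using sd_iterate_bound min by blast
  then show False using reals_Archimedean2 by (meson not_le)
qed

end

end

section \<open>Criticality, and the quadratic pair of the theorem\<close>

lemma sd_returns_critical:
  assumes "sd_returns \<rho> \<delta> \<xi> s \<sigma> h1 h2 x0 k x"
  shows "critical_point \<rho> \<delta> h1 h2 x"
  using assms
  by (auto simp: sd_returns_def critical_point_def min_norm_subgrad_def is_arg_min_def)

text \<open>The sum of the two quadratics at level \<open>2 * K\<close> stands for their mean at
  level \<open>K\<close>. Where the form of \<open>A1 + A2\<close> vanishes, both forms vanish, so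
  the vector lies in both null spaces.\<close>

lemma bounded_max_sublevel:
  fixes A1 A2 :: "real ^ 'n ^ 'n"
  assumes psd: "pos_semidef A1" "pos_semidef A2"
    and null: "null_space A1 \<inter> null_space A2 = {0}"
  shows "bounded {x. max_fun (quadratic A1 b1 c1) (quadratic A2 b2 c2) x \<le> K}"
proof (rule bounded_subset)
  have "0 < v \<bullet> ((A1 + A2) *v v)" if "v \<noteq> 0" for v
  proof -
    have "0 \<le> v \<bullet> (A1 *v v)" "0 \<le> v \<bullet> (A2 *v v)" using psd by (auto simp: pos_semidef_def)
    moreover have "v \<bullet> (A1 *v v) \<noteq> 0 \<or> v \<bullet> (A2 *v v) \<noteq> 0"
      using that null pos_semidef_null psd by (fastforce simp: null_space_def)
    ultimately show ?thesis by (auto simp: matrix_vector_mult_add_rdistrib inner_add_right)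
  qed
  then show "bounded {x. quadratic (A1 + A2) (b1 + b2) (c1 + c2) x \<le> 2 * K}"
    by (rule bounded_quadratic_sublevel)
  show "{x. max_fun (quadratic A1 b1 c1) (quadratic A2 b2 c2) x \<le> K}
      \<subseteq> {x. quadratic (A1 + A2) (b1 + b2) (c1 + c2) x \<le> 2 * K}"
    by (auto simp: max_fun_def quadratic_def matrix_vector_mult_add_rdistrib inner_add_right
        inner_add_left add_divide_distrib)
qed

lemma affine_image_bound:
  fixes A :: "real ^ 'n ^ 'm"
  assumes "bounded S"
  obtains K where "\<And>x. x \<in> S \<Longrightarrow> norm (A *v x + b) \<le> K"
proof -
  have "bounded ((\<lambda>x. b + x) ` (\<lambda>x. A *v x) ` S)"
    using assms by (intro bounded_translation bounded_linear_image matrix_vector_mul_bounded_linear)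
  then show thesis using that by (auto simp: bounded_iff add.commute)
qed

theorem theorem3p11:
  fixes Q1 Q2 A1 A2 :: "real ^ 'n ^ 'n"
    and b1 b2 x0 xstar :: "real ^ 'n"
    and c l1 l2 L :: real
    and f1 f2 h1 h2 H :: "real ^ 'n \<Rightarrow> real"
  assumes "transpose Q1 = Q1" and "transpose Q2 = Q2"
    and "null_space Q1 \<inter> null_space Q2 = {0}"
    and "f1 = quadratic Q1 b1 0" and "f2 = quadratic Q2 b2 c"
    and "\<not> (convex_on UNIV f1 \<and> convex_on UNIV f2)"
    and "\<exists>x. f2 x < 0"
    and "{l. 0 \<le> l \<and> pos_semidef (Q1 + l *\<^sub>R Q2)} = {l1..l2}" and "l1 < l2"
    and "h1 = (\<lambda>x. f1 x + l1 * f2 x)" and "h2 = (\<lambda>x. f1 x + l2 * f2 x)"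
    and "A1 = Q1 + l1 *\<^sub>R Q2" and "A2 = Q1 + l2 *\<^sub>R Q2"
    and "H = max_fun h1 h2"
    and "L = max (lambda_max A1) (lambda_max A2)"
    and "\<And>x. H xstar \<le> H x"
  shows "\<exists>G>0. \<forall>\<xi> s \<sigma>. 0 < \<xi> \<and> \<xi> \<le> 1 \<and> 0 < s \<and> s < 1 \<and> 0 < \<sigma> \<and> \<sigma> \<le> 1 / 2 \<longrightarrow>
    (\<forall>\<rho> \<delta>. 0 < \<rho> \<and> 0 < \<delta> \<longrightarrow>
      (\<exists>k x. sd_returns \<rho> \<delta> \<xi> s \<sigma> h1 h2 x0 k x) \<and>
      (\<forall>k x. sd_returns \<rho> \<delta> \<xi> s \<sigma> h1 h2 x0 k x \<longrightarrow> critical_point \<rho> \<delta> h1 h2 x) \<and>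
      (\<forall>k x. sd_iterate \<rho> \<delta> \<xi> s \<sigma> h1 h2 x0 k x \<longrightarrow>
        real k \<le> (H x0 - H xstar) / (\<sigma> * s * min (1 / L) (min \<xi> (\<rho> / (2 * G\<^sup>2))) * \<delta>\<^sup>2)))"
proof -
  have "l1 \<in> {l1..l2}" "l2 \<in> {l1..l2}" using assms(9) by auto
  then have psd: "pos_semidef A1" "pos_semidef A2"
    unfolding assms(8)[symmetric] assms(12,13) by auto
  then have sym: "transpose A1 = A1" "transpose A2 = A2" by (auto simp: pos_semidef_def)
  have mv: "(Q1 + l *\<^sub>R Q2) *v x = Q1 *v x + l *\<^sub>R (Q2 *v x)" for l x
    by (simp add: matrix_vector_mult_add_rdistrib flip: scaleR_matrix_vector_assoc)
  have h1: "h1 = quadratic A1 (b1 + l1 *\<^sub>R b2) (l1 * c)"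
    by (auto simp: fun_eq_iff assms(4,5,10,12) quadratic_def mv inner_add_left inner_add_right
        algebra_simps simp flip: scaleR_matrix_vector_assoc)
  have h2: "h2 = quadratic A2 (b1 + l2 *\<^sub>R b2) (l2 * c)"
    by (auto simp: fun_eq_iff assms(4,5,11,13) quadratic_def mv inner_add_left inner_add_right
        algebra_simps simp flip: scaleR_matrix_vector_assoc)
  \<comment> \<open>Subtracting the two equations leaves a nonzero multiple of
    \<open>Q2 *v v\<close>, because \<open>l1 < l2\<close>.\<close>
  have "v \<in> null_space Q1 \<inter> null_space Q2" if "A1 *v v = 0" "A2 *v v = 0" for v
  proof -
    have eqs: "Q1 *v v + l1 *\<^sub>R (Q2 *v v) = 0" "Q1 *v v + l2 *\<^sub>R (Q2 *v v) = 0"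
      using that by (simp_all add: assms(12,13) mv)
    then have "l1 *\<^sub>R (Q2 *v v) = l2 *\<^sub>R (Q2 *v v)" by (metis add_left_cancel)
    then have "Q2 *v v = 0" using \<open>l1 < l2\<close> by simp
    with eqs show ?thesis by (simp add: null_space_def)
  qed
  then have null: "null_space A1 \<inter> null_space A2 = {0}"
    using assms(3) by (auto simp: null_space_def)
  \<comment> \<open>A nonzero vector escapes one of the two null spaces, so that matrix has a
    positive largest eigenvalue.\<close>
  obtain v :: "real ^ 'n" where "v \<noteq> 0" by (metis axis_eq_0_iff one_neq_zero)
  then have "A1 *v v \<noteq> 0 \<or> A2 *v v \<noteq> 0" using null by (auto simp: null_space_def)
  then have L_pos: "0 < L"
    using lambda_max_pos[OF psd(1)] lambda_max_pos[OF psd(2)] by (auto simp: assms(15) less_max_iff_disj)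
  let ?S = "{x. max_fun h1 h2 x \<le> max_fun h1 h2 x0}"
  have S: "bounded ?S" unfolding h1 h2 by (rule bounded_max_sublevel[OF psd null])
  obtain K1 where K1: "\<And>x. x \<in> ?S \<Longrightarrow> norm (gradient h1 x) \<le> K1"
    unfolding h1 gradient_quadratic[OF sym(1)] using affine_image_bound[OF S[unfolded h1]] by blast
  obtain K2 where K2: "\<And>x. x \<in> ?S \<Longrightarrow> norm (gradient h2 x) \<le> K2"
    unfolding h2 gradient_quadratic[OF sym(2)] using affine_image_bound[OF S[unfolded h2]] by blast
  \<comment> \<open>The 1 ensures positivity. \<open>K1\<close> and \<open>K2\<close> come from the
    sublevel set of \<open>x0\<close> alone, so \<open>G\<close> is fixed before the parameters of
    the algorithm.\<close>
  define G where "G = max 1 (max K1 K2)"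
  interpret smooth_pair h1 h2 L G x0
  proof
    show "h1 (x + d) \<le> h1 x + gradient h1 x \<bullet> d + L / 2 * (norm d)\<^sup>2" for x d
      unfolding h1 by (rule quadratic_descent[OF sym(1)]) (simp add: assms(15))
    show "h2 (x + d) \<le> h2 x + gradient h2 x \<bullet> d + L / 2 * (norm d)\<^sup>2" for x d
      unfolding h2 by (rule quadratic_descent[OF sym(2)]) (simp add: assms(15))
    show "0 < L" by (rule L_pos)
    show "0 < G" by (simp add: G_def)
    show "norm (gradient h1 x) \<le> G" if "max_fun h1 h2 x \<le> max_fun h1 h2 x0" for x
      using K1[of x] that by (simp add: G_def)
    show "norm (gradient h2 x) \<le> G" if "max_fun h1 h2 x \<le> max_fun h1 h2 x0" for x
      using K2[of x] that by (simp add: G_def)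
  qed
  show ?thesis
  proof (rule exI[of _ G], intro conjI allI impI)
    show "0 < G" by (rule G_pos)
    fix \<xi> s \<sigma> \<rho> \<delta> :: real
    assume "0 < \<xi> \<and> \<xi> \<le> 1 \<and> 0 < s \<and> s < 1 \<and> 0 < \<sigma> \<and> \<sigma> \<le> 1 / 2" "0 < \<rho> \<and> 0 < \<delta>"
    then have pos: "0 < \<rho>" "0 < \<delta>" "0 < \<xi>" "0 < s" "s < 1" "0 < \<sigma>" "\<sigma> \<le> 1 / 2" by auto
    note min = assms(16)[unfolded assms(14)]
    show "\<exists>k x. sd_returns \<rho> \<delta> \<xi> s \<sigma> h1 h2 x0 k x"
      by (rule sd_terminates[OF pos min])
    fix k x
    show "critical_point \<rho> \<delta> h1 h2 x" if "sd_returns \<rho> \<delta> \<xi> s \<sigma> h1 h2 x0 k x"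
      using that by (rule sd_returns_critical)
    show "real k \<le> (H x0 - H xstar) / (\<sigma> * s * min (1 / L) (min \<xi> (\<rho> / (2 * G\<^sup>2))) * \<delta>\<^sup>2)"
      if "sd_iterate \<rho> \<delta> \<xi> s \<sigma> h1 h2 x0 k x"
      unfolding assms(14) by (rule sd_iterate_bound[OF pos that min])
  qed
qed

end
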